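(* Let $S$ be a standard Borel space and let $P:S\twoheadrightarrow S$ be a finitary stochastic effectivity function. If two states $s,t\in S$ satisfy exactly the same formulas of the logic $\mathcal{L}$, then they are state bisimilar, i.e., there is a state bisimulation $R$ on $P$ with $s\,R\,t$.
   Context: For a measurable space $S$, $\mathcal{S}(S)$ is the set of subprobability measures on $S$ with the $\sigma$-algebra $w(S)$ generated by the sets $\{\mu\mid\mu(A)\bowtie q\}$ ($A$ measurable, $q\in[0,1]$, $\bowtie\in\{\le,<,\ge,>\}$). $\mathfrak{V}(S)$ is the set of upper closed subsets of $w(S)$. A stochastic effectivity function $P:S\twoheadrightarrow S$ is a map $P:S\to\mathfrak{V}(S)$ which is t-measurable: for every $H\in w(S)\otimes\mathcal{B}([0,1])$, $\{\langle s,q\rangle\mid H_q\in P(s)\}\in\Sigma(S)\otimes\mathcal{B}([0,1])$, where $H_q=\{\mu\mid\langle\mu,q\rangle\in H\}$. For $W\in w(S)$ let $\mathfrak{F}(W)=\{U\in w(S)\mid W\subseteq U\}$. $P$ is finitary if for each $s$ there are finitely many finite sets $\kappa_1(s),\dots,\kappa_{n_s}(s)$ of subprobability measures on $S$ with $P(s)=\bigcup_{i=1}^{n_s}\mathfrak{F}(\kappa_i(s))$. The dual is $\partial P(s)=\{D\in w(S)\mid \mathcal{S}(S)\setminus D\notin P(s)\}$. For a relation $R$ on $S$, a set $Q$ is $R$-closed if $x\in Q$, $x R y$ imply $y\in Q$; for measures, $\mu\,\bar R\,\nu$ iff $\mu$ and $\nu$ coincide on all measurable $R$-closed sets. A state bisimulation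 on $P$ is a symmetric relation $R\subseteq S\times S$ such that whenever $s R t$, for each $A\in P(s)$ there is $B\in P(t)$ such that for each $\nu\in B$ there is $\mu\in A$ with $\mu\,\bar R\,\nu$. The logic $\mathcal{L}$ has state formulas $\phi::=\top\mid\phi_1\wedge\phi_2\mid\lozenge\psi\mid\Box\psi$ and measure formulas $\psi::=\psi_1\wedge\psi_2\mid\psi_1\vee\psi_2\mid[\phi\bowtie q]$ with $\bowtie\in\{<,>\}$ and $q\in[0,1)$ rational; $\mathcal{L}$-formulas are the state formulas. Semantics: $[\![\phi]\!]=\{s\mid s\models\phi\}$, $[\![\psi]\!]=\{\mu\in\mathcal{S}(S)\mid\mu\models\psi\}$ (these sets are measurable), Boolean connectives as usual, $s\models\lozenge\psi$ iff $[\![\psi]\!]\in P(s)$, $s\models\Box\psi$ iff $[\![\psi]\!]\in\partial P(s)$, $\mu\models[\phi\bowtie q]$ iff $\mu([\![\phi]\!])\bowtie q$. *)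

theory Defs
  imports "HOL-Probability.Probability"
begin

definition standard_borel :: "'a measure \<Rightarrow> bool" where
  "standard_borel S \<longleftrightarrow>
     (\<exists>X. completely_metrizable_space X \<and> separable_space X \<and>
          topspace X = space S \<and> sets S = sigma_sets (topspace X) {U. openin X U})"

text \<open>The set of subprobability measures on \<open>S\<close> is \<open>space (subprob_algebra S)\<close>, and \<open>w(S)\<close> is
  \<open>sets (subprob_algebra S)\<close>.  The library generates the latter by the evaluation maps; the
  following lemma gives the presentation by the sets of measures compared with \<open>q \<in> [0,1]\<close>.\<close>

definition weak_generators :: "'a measure \<Rightarrow> 'a measure set set" where
  "weak_generators S =
     {{\<mu> \<in> space (subprob_algebra S). cmp (measure \<mu> A) q} | A q cmp.
        A \<in> sets S \<and> q \<in> {0..1::real} \<and> cmp \<in> {(\<le>), (<), (\<ge>), (>)}}"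

lemma sets_subprob_algebra_eq:
  "sets (subprob_algebra S) = sigma_sets (space (subprob_algebra S)) (weak_generators S)"
proof
  let ?X = "space (subprob_algebra S)"
  let ?N = "sigma ?X (weak_generators S)"
  have sub: "weak_generators S \<subseteq> Pow ?X"
    by (auto simp: weak_generators_def)
  have setsN: "sets ?N = sigma_sets ?X (weak_generators S)"
    using sub by simp
  have spN: "space ?N = ?X"
    by (simp add: space_measure_of_conv)
  have ev: "(\<lambda>\<mu>. emeasure \<mu> A) \<in> borel_measurable ?N" if A: "A \<in> sets S" for A
  proof -
    have "(\<lambda>\<mu>. measure \<mu> A) \<in> borel_measurable ?N"
    proof (subst borel_measurable_iff_le, intro allI)
      fix q :: real
      have bnd: "0 \<le> measure \<mu> A \<and> measure \<mu> A \<le> 1" if "\<mu> \<in> ?X" for \<mu>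
        using that by (auto simp: space_subprob_algebra subprob_space.subprob_measure_le_1)
      consider "q < 0" | "q > 1" | "0 \<le> q" "q \<le> 1" by linarith
      then show "{\<mu> \<in> space ?N. measure \<mu> A \<le> q} \<in> sets ?N"
      proof cases
        case 1
        then have "{\<mu> \<in> space ?N. measure \<mu> A \<le> q} = {}"
          using bnd unfolding spN by fastforce
        then show ?thesis by (simp only: sets.empty_sets)
      next
        case 2
        then have "{\<mu> \<in> space ?N. measure \<mu> A \<le> q} = space ?N"
          using bnd unfolding spN by fastforce
        then show ?thesis by (simp only: sets.top)
      next
        case 3
        then have "{\<mu> \<in> space ?N. measure \<mu> A \<le> q} \<in> weak_generators S"
          unfolding spN by (unfold weak_generators_def) (use A in auto)
        then show ?thesis unfolding setsN by (rule sigma_sets.Basic)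
      qed
    qed
    then have "(\<lambda>\<mu>. ennreal (measure \<mu> A)) \<in> borel_measurable ?N"
      by measurable
    moreover have "ennreal (measure \<mu> A) = emeasure \<mu> A" if "\<mu> \<in> space ?N" for \<mu>
    proof -
      interpret subprob_space \<mu>
        using that unfolding spN by (simp add: space_subprob_algebra)
      show ?thesis by (simp add: emeasure_eq_measure)
    qed
    ultimately show ?thesis
      by (subst measurable_cong[where g = "\<lambda>\<mu>. ennreal (measure \<mu> A)"]) auto
  qed
  have "id \<in> measurable ?N (subprob_algebra S)"
    using ev by (intro measurable_subprob_algebra) (simp_all only: spN id_apply, simp_all add: space_subprob_algebra)
  then have "A \<in> sets ?N" if "A \<in> sets (subprob_algebra S)" for A
    using measurable_sets[OF _ that, of id ?N] sets.sets_into_space[OF that]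
    by (simp add: spN Int_absorb2)
  then show "sets (subprob_algebra S) \<subseteq> sigma_sets ?X (weak_generators S)"
    unfolding setsN by blast
next
  have [measurable]: "(\<lambda>\<mu>. measure \<mu> A) \<in> borel_measurable (subprob_algebra S)" if "A \<in> sets S" for A
    using that by (rule measurable_measure_subprob_algebra)
  show "sigma_sets (space (subprob_algebra S)) (weak_generators S) \<subseteq> sets (subprob_algebra S)"
    by (rule sets.sigma_sets_subset) (auto simp: weak_generators_def)
qed

definition upper_closed :: "'a measure \<Rightarrow> 'a measure set set \<Rightarrow> bool" where
  "upper_closed S V \<longleftrightarrow> V \<subseteq> sets (subprob_algebra S) \<and>
     (\<forall>A\<in>V. \<forall>B\<in>sets (subprob_algebra S). A \<subseteq> B \<longrightarrow> B \<in> V)"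

definition t_measurable :: "'a measure \<Rightarrow> ('a \<Rightarrow> 'a measure set set) \<Rightarrow> bool" where
  "t_measurable S P \<longleftrightarrow>
     (\<forall>H \<in> sets (subprob_algebra S \<Otimes>\<^sub>M restrict_space borel {0..1::real}).
        {(s, q). s \<in> space S \<and> q \<in> {0..1} \<and> {\<mu>. (\<mu>, q) \<in> H} \<in> P s}
          \<in> sets (S \<Otimes>\<^sub>M restrict_space borel {0..1::real}))"

text \<open>A map on the carrier \<open>space S\<close> is represented by a total function whose values outside
  \<open>space S\<close> are irrelevant.\<close>

definition stochastic_effectivity :: "'a measure \<Rightarrow> ('a \<Rightarrow> 'a measure set set) \<Rightarrow> bool" where
  "stochastic_effectivity S P \<longleftrightarrow> (\<forall>s\<in>space S. upper_closed S (P s)) \<and> t_measurable S P"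

definition up_set :: "'a measure \<Rightarrow> 'a measure set \<Rightarrow> 'a measure set set" where
  "up_set S W = {U \<in> sets (subprob_algebra S). W \<subseteq> U}"

definition finitary :: "'a measure \<Rightarrow> ('a \<Rightarrow> 'a measure set set) \<Rightarrow> bool" where
  "finitary S P \<longleftrightarrow>
     (\<forall>s\<in>space S. \<exists>(n::nat) \<kappa>.
        (\<forall>i\<in>{1..n}. finite (\<kappa> i) \<and> \<kappa> i \<subseteq> space (subprob_algebra S)) \<and>
        P s = (\<Union>i\<in>{1..n}. up_set S (\<kappa> i)))"

definition dual :: "'a measure \<Rightarrow> ('a \<Rightarrow> 'a measure set set) \<Rightarrow> 'a \<Rightarrow> 'a measure set set" where
  "dual S P s = {D \<in> sets (subprob_algebra S). space (subprob_algebra S) - D \<notin> P s}"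

definition rel_closed :: "('a \<times> 'a) set \<Rightarrow> 'a set \<Rightarrow> bool" where
  "rel_closed R Q \<longleftrightarrow> (\<forall>x\<in>Q. \<forall>y. (x, y) \<in> R \<longrightarrow> y \<in> Q)"

definition lift_rel :: "'a measure \<Rightarrow> ('a \<times> 'a) set \<Rightarrow> 'a measure \<Rightarrow> 'a measure \<Rightarrow> bool" where
  "lift_rel S R \<mu> \<nu> \<longleftrightarrow> (\<forall>Q\<in>sets S. rel_closed R Q \<longrightarrow> emeasure \<mu> Q = emeasure \<nu> Q)"

definition state_bisimulation ::
  "'a measure \<Rightarrow> ('a \<Rightarrow> 'a measure set set) \<Rightarrow> ('a \<times> 'a) set \<Rightarrow> bool" where
  "state_bisimulation S P R \<longleftrightarrow> R \<subseteq> space S \<times> space S \<and> sym R \<and>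
     (\<forall>(s, t)\<in>R. \<forall>A\<in>P s. \<exists>B\<in>P t. \<forall>\<nu>\<in>B. \<exists>\<mu>\<in>A. lift_rel S R \<mu> \<nu>)"

typedef threshold = "{q::rat. 0 \<le> q \<and> q < 1}"
  by (rule exI[of _ 0]) simp

datatype state_formula =
    Top
  | Conj state_formula state_formula
  | Diamond measure_formula
  | Box measure_formula
and measure_formula =
    MConj measure_formula measure_formula
  | MDisj measure_formula measure_formula
  | Less state_formula threshold
  | Greater state_formula threshold

primrec state_sat ::
    "'a measure \<Rightarrow> ('a \<Rightarrow> 'a measure set set) \<Rightarrow> state_formula \<Rightarrow> 'a \<Rightarrow> bool"
  and measure_sat ::
    "'a measure \<Rightarrow> ('a \<Rightarrow> 'a measure set set) \<Rightarrow> measure_formula \<Rightarrow> 'a measure \<Rightarrow> bool"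
where
  "state_sat S P Top s \<longleftrightarrow> True"
| "state_sat S P (Conj \<phi>\<^sub>1 \<phi>\<^sub>2) s \<longleftrightarrow> state_sat S P \<phi>\<^sub>1 s \<and> state_sat S P \<phi>\<^sub>2 s"
| "state_sat S P (Diamond \<psi>) s \<longleftrightarrow>
     {\<mu> \<in> space (subprob_algebra S). measure_sat S P \<psi> \<mu>} \<in> P s"
| "state_sat S P (Box \<psi>) s \<longleftrightarrow>
     {\<mu> \<in> space (subprob_algebra S). measure_sat S P \<psi> \<mu>} \<in> dual S P s"
| "measure_sat S P (MConj \<psi>\<^sub>1 \<psi>\<^sub>2) \<mu> \<longleftrightarrow> measure_sat S P \<psi>\<^sub>1 \<mu> \<and> measure_sat S P \<psi>\<^sub>2 \<mu>"
| "measure_sat S P (MDisj \<psi>\<^sub>1 \<psi>\<^sub>2) \<mu> \<longleftrightarrow> measure_sat S P \<psi>\<^sub>1 \<mu> \<or> measure_sat S P \<psi>\<^sub>2 \<mu>"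
| "measure_sat S P (Less \<phi> q) \<mu> \<longleftrightarrow>
     measure \<mu> {s \<in> space S. state_sat S P \<phi> s} < of_rat (Rep_threshold q)"
| "measure_sat S P (Greater \<phi> q) \<mu> \<longleftrightarrow>
     measure \<mu> {s \<in> space S. state_sat S P \<phi> s} > of_rat (Rep_threshold q)"

end

theory Submission
  imports Defs
begin

text \<open>Logical equivalence \<open>R\<close> is a state bisimulation.  If \<open>x R y\<close> and a finite set \<open>K\<close> of measures
  generates part of \<open>P x\<close>, let \<open>B\<close> consist of the measures that agree with some member of \<open>K\<close> on
  all formulas.  If no finite generator of \<open>P y\<close> lay inside \<open>B\<close>, each would contain a measure that
  threshold formulas separate from every member of \<open>K\<close>; the disjunction over \<open>K\<close> of the conjunctions
  of these finitely many formulas would then distinguish \<open>x\<close> from \<open>y\<close> under a diamond.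

  It remains that two measures agreeing on all formulas agree on every measurable \<open>R\<close>-closed set
  \<open>Q\<close>.  This replaces an appeal to Blackwell's theorem by an inner approximation: up to \<open>e\<close>, \<open>Q\<close> is
  filled by a compact \<open>K\<close> on which every formula is relatively clopen.  By compactness the
  \<open>R\<close>-saturation of \<open>K\<close> is a countable intersection of finite unions of finitely determined
  classes, so it lies in the \<open>\<sigma>\<close>-algebra generated by the formulas, and it is contained in \<open>Q\<close>.\<close>

section \<open>Approximation of Borel sets by closed sets\<close>

lemma closedin_in_sets:
  assumes "sets M = sigma_sets (topspace X) {U. openin X U}" and "closedin X F"
  shows "F \<in> sets M"
proof -
  have "topspace X - (topspace X - F) \<in> sets M"
    unfolding assms(1) using assms(2) by (intro sigma_sets.Compl sigma_sets.Basic) blast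
  then show ?thesis
    using closedin_subset[OF assms(2)] by (simp add: double_diff)
qed

context finite_measure
begin

lemma measure_UN_le_geometric:
  assumes "\<And>n. A n \<in> sets M" and "\<And>n. measure M (A n) \<le> e * (1/2) ^ Suc n"
  shows "measure M (\<Union>n. A n) \<le> e"
proof -
  have s: "(\<lambda>n. e * (1/2) ^ Suc n) sums e"
    using sums_mult[OF power_half_series, of e] by simp
  have summ: "summable (\<lambda>n. measure M (A n))"
    by (rule summable_comparison_test[OF _ sums_summable[OF s]]) (use assms(2) in auto)
  have "measure M (\<Union>n. A n) \<le> (\<Sum>n. measure M (A n))"
    using assms(1) summ by (intro finite_measure_subadditive_countably) auto
  also have "\<dots> \<le> (\<Sum>n. e * (1/2) ^ Suc n)"
    by (rule suminf_le[OF assms(2) summ sums_summable[OF s]])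
  also have "\<dots> = e"
    using s by (rule sums_unique[symmetric])
  finally show ?thesis .
qed

text \<open>Continuity from above, in the form that replaces a countable union by one of its finite
  stages at the cost of a strict inequality.\<close>

lemma measure_INT_decseq_less:
  assumes "\<And>n. A n \<in> sets M" and "decseq A" and "measure M (\<Inter>n. A n) < c"
  shows "\<exists>n. measure M (A n) < c"
proof -
  have "(\<lambda>n. measure M (A n)) \<longlonglongrightarrow> measure M (\<Inter>n. A n)"
    using assms by (intro finite_Lim_measure_decseq) auto
  then have "eventually (\<lambda>n. measure M (A n) < c) sequentially"
    using assms(3) by (rule order_tendstoD)
  then show ?thesis
    by (auto simp: eventually_sequentially)
qed

text \<open>The sets with this property form a \<sigma>-algebra containing the open sets.
  Approximating the complement by a closed \<open>G\<close>, instead of \<open>B\<close> by an open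
  superset, makes the property symmetric: complementation just swaps \<open>F\<close> and
  \<open>G\<close>. Open sets qualify because in a metrizable space they are increasing unions of
  closed sets.\<close>

lemma closed_sandwich:
  assumes X: "metrizable_space X" and top: "topspace X = space M"
    and sets: "sets M = sigma_sets (topspace X) {U. openin X U}"
    and B: "B \<in> sets M" and e: "e > 0"
  shows "\<exists>F G. closedin X F \<and> closedin X G \<and> F \<subseteq> B \<and> G \<inter> B = {} \<and>
    measure M (space M - (F \<union> G)) \<le> e"
proof -
  note closed_sets[intro] = closedin_in_sets[OF sets]
  have "B \<in> sigma_sets (topspace X) {U. openin X U}"
    using B sets by simp
  then show ?thesis
    using e
  proof (induction arbitrary: e rule: sigma_sets.induct)
    case (Basic U)
    then have U: "openin X U" by simp
    from open_imp_fsigma_in[OF X U] obtain C where C: "\<And>n. closedin X (C n)"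
      "\<And>n. C n \<subseteq> C (Suc n)" "\<Union> (range C) = U"
      by (auto simp: fsigma_in_ascending)
    let ?G = "topspace X - U"
    have G: "closedin X ?G" using U by blast
    have "\<exists>n. measure M (space M - (C n \<union> ?G)) < e"
    proof (rule measure_INT_decseq_less)
      show "space M - (C n \<union> ?G) \<in> sets M" for n
        using closed_sets[OF C(1)] closed_sets[OF G] by auto
      have "mono C"
        using C(2) by (simp add: mono_iff_le_Suc)
      then show "decseq (\<lambda>n. space M - (C n \<union> ?G))"
        unfolding decseq_def mono_def by blast
      have empty: "(\<Inter>n. space M - (C n \<union> ?G)) = {}"
        using C(3) top by auto
      show "measure M (\<Inter>n. space M - (C n \<union> ?G)) < e"
        unfolding empty using \<open>e > 0\<close> by simp
    qed
    then obtain n where "measure M (space M - (C n \<union> ?G)) < e" ..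
    then show ?case
      using C G by (intro exI[of _ "C n"] exI[of _ ?G]) auto
  next
    case Empty
    then show ?case
      by - (rule exI[of _ "{}"], rule exI[of _ "topspace X"], auto simp flip: top)
  next
    case (Compl B)
    from Compl.IH[OF Compl.prems] obtain F G where "closedin X F" "closedin X G" "F \<subseteq> B"
      "G \<inter> B = {}" "measure M (space M - (F \<union> G)) \<le> e" by blast
    then show ?case
      using closedin_subset[of X G]
      by - (rule exI[of _ G], rule exI[of _ F], auto simp: Un_commute)
  next
    case (Union B)
    \<comment> \<open>Half of \<open>e\<close> is distributed geometrically over the sets
      \<open>B n\<close>; the other half is slack for cutting the infinite union of the
      \<open>F n\<close> down to a finite one.\<close>
    have "\<forall>n. \<exists>F G. closedin X F \<and> closedin X G \<and> F \<subseteq> B n \<and> G \<inter> B n = {} \<and>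
        measure M (space M - (F \<union> G)) \<le> e/2 * (1/2) ^ Suc n"
      using Union.IH Union.prems by (metis half_gt_zero mult_pos_pos zero_less_divide_1_iff
          zero_less_numeral zero_less_power)
    then obtain F G where FG: "\<And>n. closedin X (F n)" "\<And>n. closedin X (G n)" "\<And>n. F n \<subseteq> B n"
      "\<And>n. G n \<inter> B n = {}" "\<And>n. measure M (space M - (F n \<union> G n)) \<le> e/2 * (1/2) ^ Suc n"
      by metis
    define H where "H = (\<Inter>n. G n)"
    \<comment> \<open>The intersection \<open>H\<close> is closed as it stands, but a countable
      union of closed sets need not be, hence the finite unions.\<close>
    define E where "E N = (\<Union>n\<le>N. F n)" for N :: nat
    have H: "closedin X H"
      unfolding H_def using FG(2) by (intro closedin_INT) auto
    have E: "closedin X (E N)" for N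
      unfolding E_def using FG(1) by (intro closedin_Union) auto
    have m: "space M - (F n \<union> G n) \<in> sets M" for n
      by (intro sets.Diff sets.top sets.Un closed_sets FG)
    have "\<exists>N. measure M (space M - (E N \<union> H)) < e"
    proof (rule measure_INT_decseq_less)
      show "space M - (E n \<union> H) \<in> sets M" for n
        using closed_sets[OF E] closed_sets[OF H] by auto
      show "decseq (\<lambda>n. space M - (E n \<union> H))"
        unfolding decseq_def E_def by fastforce
      \<comment> \<open>A point outside \<open>H\<close> misses some \<open>G m\<close>; being
        outside \<open>E m\<close> as well, it misses \<open>F m\<close> and falls into the gap of
        the \<open>m\<close>-th sandwich.\<close>
      have "measure M (\<Inter>n. space M - (E n \<union> H)) \<le> measure M (\<Union>n. space M - (F n \<union> G n))"
        using sets.countable_UN[of _ UNIV, OF image_subsetI[OF m]]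
        by (intro finite_measure_mono) (auto simp: E_def H_def)
      also have "\<dots> \<le> e/2"
        using m FG(5) by (rule measure_UN_le_geometric)
      also have "\<dots> < e" using Union.prems by simp
      finally show "measure M (\<Inter>n. space M - (E n \<union> H)) < e" .
    qed
    then obtain N where "measure M (space M - (E N \<union> H)) < e" ..
    moreover have "E N \<subseteq> \<Union> (range B)"
      using FG(3) by (auto simp: E_def)
    moreover have "H \<inter> \<Union> (range B) = {}"
      using FG(4) by (fastforce simp: H_def)
    ultimately show ?case
      using E H by - (rule exI[of _ "E N"], rule exI[of _ H], auto)
  qed
qed

end

section \<open>Tightness of finite measures on Polish spaces\<close>

text \<open>Total boundedness asks for centres inside \<open>T\<close>. Each ball of radius
  \<open>\<epsilon>/3\<close> that meets \<open>T\<close> is recentred at a point of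
  \<open>T\<close> in it, which at most doubles the distances to
  \<open>2\<epsilon>/3\<close>.\<close>

lemma (in Metric_space) mtotally_bounded_if_mcball_cover:
  assumes "T \<subseteq> M" and cover: "\<And>\<epsilon>. \<epsilon> > 0 \<Longrightarrow> \<exists>K. finite K \<and> T \<subseteq> (\<Union>x\<in>K. mcball x \<epsilon>)"
  shows "mtotally_bounded T"
  unfolding mtotally_bounded_def
proof (intro allI impI)
  fix \<epsilon> :: real assume "\<epsilon> > 0"
  then obtain K where K: "finite K" "T \<subseteq> (\<Union>x\<in>K. mcball x (\<epsilon>/3))"
    using cover[of "\<epsilon>/3"] by auto
  define pick where "pick x = (SOME y. y \<in> T \<inter> mcball x (\<epsilon>/3))" for x
  define K' where "K' = {x \<in> K. T \<inter> mcball x (\<epsilon>/3) \<noteq> {}}"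
  have pick: "pick x \<in> T \<inter> mcball x (\<epsilon>/3)" if "x \<in> K'" for x
    unfolding pick_def some_in_eq using that by (simp add: K'_def)
  have "T \<subseteq> (\<Union>y\<in>pick ` K'. mball y \<epsilon>)"
  proof
    fix y assume y: "y \<in> T"
    then obtain x where x: "x \<in> K" "y \<in> mcball x (\<epsilon>/3)" using K by blast
    then have "x \<in> K'" using y by (auto simp: K'_def)
    then have p: "pick x \<in> T" "pick x \<in> mcball x (\<epsilon>/3)" using pick by auto
    have "d (pick x) y \<le> d x (pick x) + d x y"
      using p x by (metis in_mcball triangle commute)
    also have "\<dots> < \<epsilon>" using p x \<open>\<epsilon> > 0\<close> by auto
    finally show "y \<in> (\<Union>y\<in>pick ` K'. mball y \<epsilon>)"
      using \<open>x \<in> K'\<close> p x by auto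
  qed
  then show "\<exists>K. finite K \<and> K \<subseteq> T \<and> T \<subseteq> (\<Union>x\<in>K. mball x \<epsilon>)"
    using K(1) pick by (intro exI[of _ "pick ` K'"]) (auto simp: K'_def)
qed

text \<open>Ulam's argument: for each \<open>n\<close>, finitely many closed balls of radius
  \<open>1 / Suc n\<close> around a dense sequence carry all but \<open>e * (1/2) ^ Suc n\<close> of
  the mass. The intersection of these finite unions is closed and totally bounded, hence compact by
  completeness.\<close>

lemma (in finite_measure) tight:
  assumes X: "completely_metrizable_space X" and sep: "separable_space X"
    and top: "topspace X = space M" and sets: "sets M = sigma_sets (topspace X) {U. openin X U}"
    and e: "e > 0"
  shows "\<exists>K. compactin X K \<and> closedin X K \<and> measure M (space M - K) \<le> e"
proof (cases "topspace X = {}")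
  case True
  then show ?thesis
    using e top by (intro exI[of _ "{}"]) auto
next
  case False
  obtain Y d where "Metric_space Y d" and complete: "Metric_space.mcomplete Y d"
    and Xeq: "X = Metric_space.mtopology Y d"
    using X unfolding completely_metrizable_space_def by blast
  then interpret Metric_space Y d by simp
  have Y: "Y = space M" using top Xeq by simp
  obtain C where C: "countable C" "C \<subseteq> Y" "mtopology closure_of C = Y"
    using sep by (auto simp: separable_space_def Xeq)
  \<comment> \<open>An enumeration indexed by all natural numbers exists only for nonempty
    \<open>C\<close>; this is why the empty space is a separate case.\<close>
  have "C \<noteq> {}" using C False by (auto simp: Xeq)
  then obtain c :: "nat \<Rightarrow> 'a" where c: "range c = C"
    using C(1) by (metis uncountable_def)
  note closed_sets = closedin_in_sets[OF sets]
  define D where "D n k = (\<Union>i\<le>k. mcball (c i) (1 / Suc n))" for n k :: nat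
  have D: "closedin X (D n k)" for n k
    unfolding D_def Xeq by (intro closedin_Union) auto
  have "\<exists>k. measure M (space M - D n k) < e * (1/2) ^ Suc n" for n
  proof (rule measure_INT_decseq_less)
    show "space M - D n k \<in> sets M" for k
      using closed_sets[OF D] by auto
    show "decseq (\<lambda>k. space M - D n k)"
      unfolding decseq_def D_def by fastforce
    have "x \<in> (\<Union>k. D n k)" if "x \<in> Y" for x
    proof -
      have "x \<in> mtopology closure_of C" using that C by simp
      then obtain y where y: "y \<in> C" "y \<in> mcball x (1 / Suc n)"
        unfolding metric_closure_of_alt by (auto dest!: spec[of _ "1 / Suc n"] simp del: of_nat_Suc)
      then obtain i where "y = c i" using c by auto
      then have "x \<in> mcball (c i) (1 / Suc n)" using y by (auto simp: commute)
      then show ?thesis by (auto simp: D_def)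
    qed
    then have empty: "(\<Inter>k. space M - D n k) = {}" using Y by auto
    show "measure M (\<Inter>k. space M - D n k) < e * (1/2) ^ Suc n"
      unfolding empty using e by simp
  qed
  then obtain k where k: "\<And>n. measure M (space M - D n (k n)) < e * (1/2) ^ Suc n"
    by metis
  define K where "K = (\<Inter>n. D n (k n))"
  have K: "closedin X K"
    unfolding K_def using D by (intro closedin_INT) auto
  have "mtotally_bounded K"
  proof (rule mtotally_bounded_if_mcball_cover)
    show "K \<subseteq> Y" using closedin_subset[OF K] Xeq by simp
    fix \<epsilon> :: real assume "\<epsilon> > 0"
    then obtain n where n: "1 / Suc n < \<epsilon>"
      using nat_approx_posE by blast
    have "K \<subseteq> D n (k n)" by (auto simp: K_def)
    also have "\<dots> \<subseteq> (\<Union>x\<in>c ` {..k n}. mcball x \<epsilon>)"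
      using n unfolding D_def by fastforce
    finally show "\<exists>J. finite J \<and> K \<subseteq> (\<Union>x\<in>J. mcball x \<epsilon>)"
      by (intro exI[of _ "c ` {..k n}"]) auto
  qed
  then have "compactin X (mtopology closure_of K)"
    using mtotally_bounded_eq_compact_closure_of[OF complete] Xeq by blast
  then have "compactin X K"
    using K by (simp add: Xeq closure_of_closedin)
  moreover have "measure M (space M - K) \<le> e"
  proof -
    have eq: "space M - K = (\<Union>n. space M - D n (k n))" by (auto simp: K_def)
    show ?thesis
      unfolding eq
      by (rule measure_UN_le_geometric[OF sets.compl_sets[OF closed_sets[OF D]] less_imp_le[OF k]])
  qed
  ultimately show ?thesis using K by blast
qed

section \<open>Inner approximation of saturated sets\<close>

text \<open>Within \<open>K\<close>, membership in \<open>A n\<close> means membership in the closed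
  \<open>F n\<close>, and non-membership means membership in the closed \<open>G n\<close>. So the
  points of \<open>K\<close> that agree with \<open>x\<close> on the first \<open>N\<close> sets
  form a decreasing sequence of nonempty closed subsets of a compact space.\<close>

lemma compact_saturation:
  fixes A :: "nat \<Rightarrow> 'a set"
  assumes K: "compactin X K" and "closedin X K"
    and F: "\<And>n. closedin X (F n)" and G: "\<And>n. closedin X (G n)"
    and FG: "K \<subseteq> (\<Inter>n. F n \<union> G n)" "\<And>n. F n \<subseteq> A n" "\<And>n. G n \<inter> A n = {}"
    and fin: "\<And>N. \<exists>y\<in>K. \<forall>n<N. x \<in> A n \<longleftrightarrow> y \<in> A n"
  shows "\<exists>y\<in>K. \<forall>n. x \<in> A n \<longleftrightarrow> y \<in> A n"
proof -
  define D where "D n = (if x \<in> A n then F n else G n)" for n :: nat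
  define C where "C N = K \<inter> (\<Inter>n<N. D n)" for N :: nat
  have D: "y \<in> D n \<longleftrightarrow> (x \<in> A n \<longleftrightarrow> y \<in> A n)" if "y \<in> K" for y n
    using subsetD[OF FG(1) that] FG(2,3)[of n] by (auto simp: D_def)
  have "(\<Inter>N. C N) \<noteq> {}"
  proof (rule compact_space_imp_nest)
    show "compact_space (subtopology X K)"
      using K by (simp add: compact_space_subtopology)
    show "closedin (subtopology X K) (C N)" for N
    proof -
      have "C N = \<Inter> (insert K (D ` {..<N}))" by (simp add: C_def)
      moreover have "closedin X \<dots>"
        by (rule closedin_Inter) (use \<open>closedin X K\<close> F G in \<open>auto simp: D_def\<close>)
      ultimately show ?thesis
        by (auto simp: C_def intro: closedin_subset_topspace)
    qed
    show "C N \<noteq> {}" for N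
      using fin[of N] D by (auto simp: C_def)
    show "decseq C"
      by (force simp: decseq_def C_def)
  qed
  then obtain y where "\<And>N. y \<in> C N" by auto
  \<comment> \<open>\<open>C N\<close> constrains only the indices below \<open>N\<close>, so
    \<open>y \<in> D n\<close> is read off from \<open>C (Suc n)\<close>.\<close>
  then have "y \<in> K" "\<And>n. y \<in> D n"
    by (auto simp: C_def dest: meta_spec[of _ "Suc _"])
  then show ?thesis using D by blast
qed

lemma (in finite_measure) inner_approx_by_saturation:
  fixes A :: "nat \<Rightarrow> 'a set"
  assumes M: "standard_borel M" and A: "\<And>n. A n \<in> sets M" and Q: "Q \<in> sets M"
    and sat: "\<And>x y. x \<in> space M \<Longrightarrow> y \<in> Q \<Longrightarrow> (\<And>n. x \<in> A n \<longleftrightarrow> y \<in> A n) \<Longrightarrow> x \<in> Q"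
    and e: "e > 0"
  shows "\<exists>B \<in> sigma_sets (space M) (range A). B \<subseteq> Q \<and> measure M Q \<le> measure M B + e"
proof -
  obtain X where X: "completely_metrizable_space X" "separable_space X" and top: "topspace X = space M"
    and sets: "sets M = sigma_sets (topspace X) {U. openin X U}"
    using M unfolding standard_borel_def by blast
  have metr: "metrizable_space X"
    using X completely_metrizable_imp_metrizable_space by blast
  note closed_sets = closedin_in_sets[OF sets]
  \<comment> \<open>The error is split into three equal shares: mass outside a compact set, the gap
    of the sandwich around \<open>Q\<close>, and the gaps around all \<open>A n\<close> together,
    the last share being divided geometrically.\<close>
  obtain K0 where K0: "compactin X K0" "closedin X K0" "measure M (space M - K0) \<le> e/3"
    using tight[OF X top sets, of "e/3"] e by auto
  obtain Q0 Q1 where Q0: "closedin X Q0" "closedin X Q1" "Q0 \<subseteq> Q" "Q1 \<inter> Q = {}"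
    "measure M (space M - (Q0 \<union> Q1)) \<le> e/3"
    using closed_sandwich[OF metr top sets Q, of "e/3"] e by auto
  have "\<forall>n. \<exists>F G. closedin X F \<and> closedin X G \<and> F \<subseteq> A n \<and> G \<inter> A n = {} \<and>
      measure M (space M - (F \<union> G)) \<le> e/3 * (1/2) ^ Suc n"
    using e by (intro allI closed_sandwich[OF metr top sets A]) simp
  then obtain F G where FG: "\<And>n. closedin X (F n)" "\<And>n. closedin X (G n)" "\<And>n. F n \<subseteq> A n"
    "\<And>n. G n \<inter> A n = {}" "\<And>n. measure M (space M - (F n \<union> G n)) \<le> e/3 * (1/2) ^ Suc n"
    by metis
  define L where "L = (\<Inter>n. F n \<union> G n)"
  have L: "closedin X L"
    unfolding L_def using FG by (intro closedin_INT) auto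
  have mL: "measure M (space M - L) \<le> e/3"
  proof -
    have "space M - L = (\<Union>n. space M - (F n \<union> G n))" by (auto simp: L_def)
    moreover have "space M - (F n \<union> G n) \<in> sets M" for n
      using FG(1,2) closed_sets by auto
    ultimately show ?thesis
      using measure_UN_le_geometric[of "\<lambda>n. space M - (F n \<union> G n)" "e/3"] FG(5) by simp
  qed
  define K where "K = K0 \<inter> (Q0 \<inter> L)"
  have cK: "compactin X K"
    unfolding K_def using K0(1) Q0(1) L by (intro compact_Int_closedin closedin_Int)
  have clK: "closedin X K"
    unfolding K_def using K0(2) Q0(1) L by (intro closedin_Int)
  have KQ: "K \<subseteq> Q" using Q0 by (auto simp: K_def)
  have mK: "measure M Q \<le> measure M K + e"
  proof -
    have ms: "K \<in> sets M" "space M - K0 \<in> sets M" "space M - (Q0 \<union> Q1) \<in> sets M" "space M - L \<in> sets M"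
      using clK K0 Q0 L closed_sets by auto
    \<comment> \<open>A point of \<open>Q\<close> outside \<open>Q0\<close> lies outside
      \<open>Q1\<close> too, so the gap of the sandwich around \<open>Q\<close> contains it.\<close>
    have "Q \<subseteq> K \<union> ((space M - K0) \<union> ((space M - (Q0 \<union> Q1)) \<union> (space M - L)))"
      using Q0 sets.sets_into_space[OF Q] by (auto simp: K_def)
    then have "measure M Q \<le> measure M (K \<union> ((space M - K0) \<union> ((space M - (Q0 \<union> Q1)) \<union> (space M - L))))"
      using ms by (intro finite_measure_mono) auto
    also have "\<dots> \<le> measure M K + measure M ((space M - K0) \<union> ((space M - (Q0 \<union> Q1)) \<union> (space M - L)))"
      using ms by (intro measure_Un_le) auto
    also have "measure M ((space M - K0) \<union> ((space M - (Q0 \<union> Q1)) \<union> (space M - L)))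
        \<le> measure M (space M - K0) + measure M ((space M - (Q0 \<union> Q1)) \<union> (space M - L))"
      using ms by (intro measure_Un_le) auto
    also have "measure M ((space M - (Q0 \<union> Q1)) \<union> (space M - L))
        \<le> measure M (space M - (Q0 \<union> Q1)) + measure M (space M - L)"
      using ms by (intro measure_Un_le) auto
    finally show ?thesis using K0(3) Q0(5) mL by linarith
  qed
  let ?N = "sigma (space M) (range A)"
  have setsN: "sets ?N = sigma_sets (space M) (range A)"
    using A sets.sets_into_space by (intro sets_measure_of) blast
  have spN: "space ?N = space M" by (simp add: space_measure_of_conv)
  have AN: "A n \<in> sets ?N" for n unfolding setsN by (rule sigma_sets.Basic) simp
  \<comment> \<open>Here the witness in \<open>K\<close> may vary with the stage \<open>N\<close>,
    which keeps \<open>B\<close> in the generated \<sigma>-algebra;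
    \<open>compact_saturation\<close> then supplies one witness for all stages, which puts
    \<open>B\<close> inside \<open>Q\<close>.\<close>
  define B where "B = (\<Inter>N. {x \<in> space M. \<exists>y\<in>K. \<forall>n<N. x \<in> A n \<longleftrightarrow> y \<in> A n})"
  have "{x \<in> space M. \<exists>y\<in>K. \<forall>n<N. x \<in> A n \<longleftrightarrow> y \<in> A n} \<in> sets ?N" for N :: nat
  proof -
    have atom: "{x \<in> space ?N. \<forall>n\<in>{..<N}. x \<in> A n \<longleftrightarrow> n \<in> J} \<in> sets ?N" for J
    proof (rule sets.sets_Collect_finite_All)
      fix n
      have "{x \<in> space ?N. x \<in> A n \<longleftrightarrow> n \<in> J} = (if n \<in> J then A n else space ?N - A n)"
        using sets.sets_into_space[OF AN, of n] by auto
      then show "{x \<in> space ?N. x \<in> A n \<longleftrightarrow> n \<in> J} \<in> sets ?N"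
        using AN by auto
    qed simp
    \<comment> \<open>However large \<open>K\<close> is, its points realise only finitely many
      membership patterns in the first \<open>N\<close> sets, and each pattern contributes one
      atom.\<close>
    let ?J = "(\<lambda>y. {n. n < N \<and> y \<in> A n}) ` K"
    have fin: "finite ?J"
      by (rule finite_subset[of _ "Pow {..<N}"]) auto
    have "{x \<in> space M. \<exists>y\<in>K. \<forall>n<N. x \<in> A n \<longleftrightarrow> y \<in> A n}
        = (\<Union>J\<in>?J. {x \<in> space ?N. \<forall>n\<in>{..<N}. x \<in> A n \<longleftrightarrow> n \<in> J})"
      unfolding spN by auto
    also have "\<dots> \<in> sets ?N"
      using fin atom by (intro sets.finite_UN) auto
    finally show ?thesis .
  qed
  then have "B \<in> sets ?N"
    unfolding B_def by (intro sets.countable_INT) auto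
  then have BN: "B \<in> sigma_sets (space M) (range A)"
    unfolding setsN .
  have "B \<subseteq> Q"
  proof
    fix x assume x: "x \<in> B"
    have "\<exists>y\<in>K. \<forall>n. x \<in> A n \<longleftrightarrow> y \<in> A n"
      by (rule compact_saturation[OF cK clK FG(1,2) _ FG(3,4)])
        (use x in \<open>auto simp: B_def K_def L_def\<close>)
    then show "x \<in> Q"
      using x KQ sat[of x] by (auto simp: B_def)
  qed
  moreover have "measure M Q \<le> measure M B + e"
  proof -
    have "sigma_sets (space M) (range A) \<subseteq> sets M"
      using A by (intro sets.sigma_sets_subset) auto
    then have "measure M K \<le> measure M B"
      using BN closedin_subset[OF clK] top by (intro finite_measure_mono) (auto simp: B_def)
    then show ?thesis using mK by linarith
  qed
  ultimately show ?thesis using BN by blast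
qed

section \<open>Agreement of two measures on saturated sets\<close>

lemma standard_borel_cong_sets:
  "sets M = sets N \<Longrightarrow> standard_borel M \<longleftrightarrow> standard_borel N"
  using sets_eq_imp_space_eq[of M N] by (simp add: standard_borel_def)

text \<open>If \<open>B\<close> inside \<open>Q\<close> is the approximation chosen for \<mu>, then
  \<mu>(Q) is at most \<mu>(B) + e = \<nu>(B) + e, hence at most \<nu>(Q) + e. Exchanging the two
  measures gives the other inequality.\<close>

lemma measure_eq_on_saturated_set:
  fixes A :: "nat \<Rightarrow> 'a set"
  assumes S: "standard_borel S" and A: "\<And>n. A n \<in> sets S" and Q: "Q \<in> sets S"
    and \<mu>: "finite_measure \<mu>" "sets \<mu> = sets S" and \<nu>: "finite_measure \<nu>" "sets \<nu> = sets S"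
    and eq: "\<And>B. B \<in> sigma_sets (space S) (range A) \<Longrightarrow> measure \<mu> B = measure \<nu> B"
    and sat: "\<And>x y. x \<in> space S \<Longrightarrow> y \<in> Q \<Longrightarrow> (\<And>n. x \<in> A n \<longleftrightarrow> y \<in> A n) \<Longrightarrow> x \<in> Q"
  shows "measure \<mu> Q = measure \<nu> Q"
proof -
  have le: "measure \<mu> Q \<le> measure \<nu> Q"
    if "finite_measure \<mu>" "sets \<mu> = sets S" "finite_measure \<nu>" "sets \<nu> = sets S"
      and eq: "\<And>B. B \<in> sigma_sets (space S) (range A) \<Longrightarrow> measure \<mu> B = measure \<nu> B" for \<mu> \<nu>
  proof (rule field_le_epsilon)
    fix e :: real assume "e > 0"
    interpret \<mu>: finite_measure \<mu> by fact
    interpret \<nu>: finite_measure \<nu> by fact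
    have sp: "space \<mu> = space S" using that sets_eq_imp_space_eq by blast
    have "\<exists>B \<in> sigma_sets (space \<mu>) (range A). B \<subseteq> Q \<and> measure \<mu> Q \<le> measure \<mu> B + e"
      by (rule \<mu>.inner_approx_by_saturation)
        (use S that sp A Q sat \<open>e > 0\<close> in \<open>auto simp: standard_borel_cong_sets[of \<mu> S]\<close>)
    then obtain B where B: "B \<in> sigma_sets (space S) (range A)" "B \<subseteq> Q"
      "measure \<mu> Q \<le> measure \<mu> B + e" using sp by auto
    have "measure \<nu> B \<le> measure \<nu> Q"
      using B(2) Q that by (intro \<nu>.finite_measure_mono) auto
    then show "measure \<mu> Q \<le> measure \<nu> Q + e"
      using B eq[OF B(1)] by simp
  qed
  show ?thesis
    using le[OF \<mu> \<nu> eq] le[OF \<nu> \<mu>] eq by (simp add: antisym)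
qed

text \<open>Dynkin's \<pi>-\<lambda> argument. Finite measures may differ in total mass, so
  \<open>space \<mu> \<in> G\<close> is what makes the complement step work.\<close>

lemma measure_eq_on_sigma_sets:
  assumes \<mu>: "finite_measure \<mu>" and \<nu>: "finite_measure \<nu>" and sets: "sets \<mu> = sets \<nu>"
    and G: "G \<subseteq> sets \<mu>" "Int_stable G" "space \<mu> \<in> G"
    and eq: "\<And>A. A \<in> G \<Longrightarrow> measure \<mu> A = measure \<nu> A"
    and B: "B \<in> sigma_sets (space \<mu>) G"
  shows "measure \<mu> B = measure \<nu> B"
proof -
  interpret \<mu>: finite_measure \<mu> by fact
  interpret \<nu>: finite_measure \<nu> by fact
  have sp: "space \<nu> = space \<mu>" using sets sets_eq_imp_space_eq by metis
  have sub: "A \<in> sets \<mu>" if "A \<in> sigma_sets (space \<mu>) G" for A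
    using that G(1) sets.sigma_sets_subset by blast
  have "G \<subseteq> Pow (space \<mu>)" using G(1) sets.sets_into_space by blast
  from G(2) this B show ?thesis
  proof (induction rule: sigma_sets_induct_disjoint)
    case (compl A)
    then show ?case
      using \<mu>.finite_measure_compl[of A] \<nu>.finite_measure_compl[of A] sub[of A] eq[OF G(3)]
      by (simp add: sets sp)
  next
    case (union A)
    then have A: "range A \<subseteq> sets \<mu>" using sub by blast
    then have "(\<lambda>i. measure \<mu> (A i)) sums measure \<mu> (\<Union>i. A i)"
      "(\<lambda>i. measure \<nu> (A i)) sums measure \<nu> (\<Union>i. A i)"
      using union(1) sets by (auto intro: \<mu>.finite_measure_UNION \<nu>.finite_measure_UNION)
    then show ?case
      using union(3) by (simp add: sums_unique2)
  qed (simp_all add: eq)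
qed

section \<open>Countability and measurability of formulas\<close>

instance threshold :: countable
  by (rule countable_classI[of "\<lambda>q. to_nat (Rep_threshold q)"]) (simp add: Rep_threshold_inject)

text \<open>Countability turns the extensions of formulas into a sequence of sets, as the
  approximation requires, and makes agreement on all formulas a measurable condition.\<close>

instance state_formula :: countable
  by countable_datatype

text \<open>The t-measurability condition is applied to the cylinder over \<open>D\<close>, whose
  sections all equal \<open>D\<close>; pulling back along the embedding of \<open>s\<close> as
  \<open>(s, 0)\<close> removes the numerical coordinate.\<close>

lemma effectivity_preimage:
  assumes "t_measurable S P" and D: "D \<in> sets (subprob_algebra S)"
  shows "{s \<in> space S. D \<in> P s} \<in> sets S"
proof -
  let ?I = "restrict_space borel {0..1::real}"
  let ?H = "D \<times> {0..1::real}"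
  let ?W = "{(s, q). s \<in> space S \<and> q \<in> {0..1} \<and> {\<mu>. (\<mu>, q) \<in> ?H} \<in> P s}"
  have "space ?I \<in> sets ?I" by (rule sets.top)
  then have "?H \<in> sets (subprob_algebra S \<Otimes>\<^sub>M ?I)"
    using D by (intro pair_measureI) (simp_all add: space_restrict_space)
  then have W: "?W \<in> sets (S \<Otimes>\<^sub>M ?I)"
    using assms(1) unfolding t_measurable_def by blast
  have "(\<lambda>s. (s, 0)) \<in> measurable S (S \<Otimes>\<^sub>M ?I)"
    by (intro measurable_Pair measurable_const) (auto simp: space_restrict_space)
  from measurable_sets[OF this W] show ?thesis
    by (rule back_subst[where P = "\<lambda>A. A \<in> sets S"]) auto
qed

text \<open>The two claims feed each other: modalities need measurable sets of measures, thresholds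
  need measurable sets of states.\<close>

lemma sets_satisfaction:
  assumes P: "t_measurable S P"
  shows sets_state_sat: "{s \<in> space S. state_sat S P \<phi> s} \<in> sets S"
    and sets_measure_sat:
      "{\<mu> \<in> space (subprob_algebra S). measure_sat S P \<psi> \<mu>} \<in> sets (subprob_algebra S)"
proof (induction \<phi> and \<psi>)
  case (Diamond \<psi>)
  then show ?case using effectivity_preimage[OF P] by simp
next
  case (Box \<psi>)
  let ?D = "{\<mu> \<in> space (subprob_algebra S). measure_sat S P \<psi> \<mu>}"
  have "{s \<in> space S. state_sat S P (Box \<psi>) s}
      = space S - {s \<in> space S. space (subprob_algebra S) - ?D \<in> P s}"
    using Box by (auto simp: dual_def)
  then show ?case
    using effectivity_preimage[OF P sets.compl_sets[OF Box]] sets.compl_sets by simp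
next
  case (Less \<phi> q)
  then have "(\<lambda>\<mu>. measure \<mu> {s \<in> space S. state_sat S P \<phi> s}) \<in> borel_measurable (subprob_algebra S)"
    by (rule measurable_measure_subprob_algebra)
  then show ?case by simp
next
  case (Greater \<phi> q)
  then have "(\<lambda>\<mu>. measure \<mu> {s \<in> space S. state_sat S P \<phi> s}) \<in> borel_measurable (subprob_algebra S)"
    by (rule measurable_measure_subprob_algebra)
  then show ?case by simp
qed simp_all

section \<open>Separation of measures by formulas\<close>

lemma threshold_between:
  fixes a b :: real
  assumes "0 \<le> a" "a < b" "b \<le> 1"
  obtains q where "a < of_rat (Rep_threshold q)" "of_rat (Rep_threshold q) < b"
proof -
  obtain r where r: "a < of_rat r" "of_rat r < b"
    using of_rat_dense[OF assms(2)] by blast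
  have "0 \<le> r" "r < 1"
    using assms r by (metis le_less_trans less_imp_le zero_less_of_rat_iff,
        metis less_le_trans of_rat_less_1_iff)
  then have "Rep_threshold (Abs_threshold r) = r" by (simp add: Abs_threshold_inverse)
  then show thesis using that r by metis
qed

text \<open>Without negation the formula cannot be flipped afterwards, so \<open>Less\<close> or
  \<open>Greater\<close> is chosen according to which measure gives the larger value, with a
  rational threshold strictly between.\<close>

lemma separating_measure_formula:
  assumes "\<mu> \<in> space (subprob_algebra S)" "\<nu> \<in> space (subprob_algebra S)"
    and "measure \<mu> {s \<in> space S. state_sat S P \<phi> s} \<noteq> measure \<nu> {s \<in> space S. state_sat S P \<phi> s}"
  shows "\<exists>\<psi>. measure_sat S P \<psi> \<mu> \<and> \<not> measure_sat S P \<psi> \<nu>"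
proof -
  have le1: "measure \<rho> A \<le> 1" if "\<rho> \<in> space (subprob_algebra S)" for \<rho> and A :: "'a set"
    using that by (simp add: space_subprob_algebra subprob_space.subprob_measure_le_1)
  let ?A = "{s \<in> space S. state_sat S P \<phi> s}"
  consider "measure \<mu> ?A < measure \<nu> ?A" | "measure \<nu> ?A < measure \<mu> ?A"
    using assms(3) by linarith
  then show ?thesis
  proof cases
    case 1
    then obtain q where "measure \<mu> ?A < of_rat (Rep_threshold q)" "of_rat (Rep_threshold q) < measure \<nu> ?A"
      using threshold_between le1[OF assms(2)] measure_nonneg by blast
    then show ?thesis by (intro exI[of _ "Less \<phi> q"]) auto
  next
    case 2
    then obtain q where "measure \<nu> ?A < of_rat (Rep_threshold q)" "of_rat (Rep_threshold q) < measure \<mu> ?A"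
      using threshold_between le1[OF assms(1)] measure_nonneg by blast
    then show ?thesis by (intro exI[of _ "Greater \<phi> q"]) auto
  qed
qed

text \<open>Generators of an effectivity function may be empty, so the empty disjunction matters. It
  is expressed as total mass below 0, which never holds.\<close>

lemma ex_finite_MDisj:
  assumes "finite I"
  shows "\<exists>\<psi>. \<forall>\<mu>. measure_sat S P \<psi> \<mu> \<longleftrightarrow> (\<exists>i\<in>I. measure_sat S P (f i) \<mu>)"
  using assms
proof induction
  case empty
  have "Rep_threshold (Abs_threshold 0) = 0" by (simp add: Abs_threshold_inverse)
  then show ?case
    by (intro exI[of _ "Less Top (Abs_threshold 0)"]) (simp add: not_less)
next
  case (insert i I)
  then obtain \<psi> where "\<forall>\<mu>. measure_sat S P \<psi> \<mu> \<longleftrightarrow> (\<exists>i\<in>I. measure_sat S P (f i) \<mu>)" by blast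
  then show ?case by (intro exI[of _ "MDisj (f i) \<psi>"]) simp
qed

lemma ex_finite_MConj:
  assumes "finite I"
  shows "\<exists>\<psi>. \<forall>\<mu>. measure_sat S P \<psi> \<mu> \<longleftrightarrow> (\<forall>i\<in>I. measure_sat S P (f i) \<mu>)"
  using assms
proof induction
  case empty
  \<comment> \<open>The empty conjunction is total mass below 1/2 or above 0: a mass that is not
    positive is 0 and hence below 1/2.\<close>
  have "Rep_threshold (Abs_threshold 0) = 0" "Rep_threshold (Abs_threshold (1/2)) = 1/2"
    by (simp_all add: Abs_threshold_inverse)
  then show ?case
    by (intro exI[of _ "MDisj (Less Top (Abs_threshold (1/2))) (Greater Top (Abs_threshold 0))"])
      (auto simp: of_rat_divide not_less zero_less_measure_iff)
next
  case (insert i I)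
  then obtain \<psi> where "\<forall>\<mu>. measure_sat S P \<psi> \<mu> \<longleftrightarrow> (\<forall>i\<in>I. measure_sat S P (f i) \<mu>)" by blast
  then show ?case by (intro exI[of _ "MConj (f i) \<psi>"]) simp
qed

section \<open>Logical equivalence as a bisimulation\<close>

text \<open>By \<open>Conj\<close> and \<open>Top\<close> the extensions form a \<pi>-system
  containing the whole space, so agreement passes to the \<sigma>-algebra they generate. If
  \<open>R\<close> contains logical equivalence, its closed sets are saturated for it, and agreement
  passes on to them.\<close>

lemma lift_rel_if_formulas_agree:
  assumes S: "standard_borel S" and P: "t_measurable S P"
    and \<mu>: "\<mu> \<in> space (subprob_algebra S)" and \<nu>: "\<nu> \<in> space (subprob_algebra S)"
    and eq: "\<And>\<phi>. measure \<mu> {s \<in> space S. state_sat S P \<phi> s} = measure \<nu> {s \<in> space S. state_sat S P \<phi> s}"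
    and R: "\<And>x y. x \<in> space S \<Longrightarrow> y \<in> space S \<Longrightarrow>
      (\<And>\<phi>. state_sat S P \<phi> x \<longleftrightarrow> state_sat S P \<phi> y) \<Longrightarrow> (x, y) \<in> R"
  shows "lift_rel S R \<mu> \<nu>"
  unfolding lift_rel_def
proof (intro ballI impI)
  fix Q assume Q: "Q \<in> sets S" "rel_closed R Q"
  let ?ext = "\<lambda>\<phi>. {s \<in> space S. state_sat S P \<phi> s}"
  define A where "A n = ?ext (from_nat n)" for n :: nat
  have \<mu>': "finite_measure \<mu>" "sets \<mu> = sets S" and \<nu>': "finite_measure \<nu>" "sets \<nu> = sets S"
    using \<mu> \<nu> by (auto simp: space_subprob_algebra subprob_space_def)
  have sp: "space \<mu> = space S" using \<mu>'(2) by (rule sets_eq_imp_space_eq)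
  have A: "A n \<in> sets S" for n
    unfolding A_def by (rule sets_state_sat[OF P])
  have ext: "?ext \<phi> = A (to_nat \<phi>)" for \<phi> by (simp add: A_def)
  have "A m \<inter> A n = A (to_nat (Conj (from_nat m) (from_nat n)))" for m n
    by (auto simp: A_def)
  then have stable: "Int_stable (range A)"
    by (auto simp: Int_stable_def)
  have top: "space \<mu> \<in> range A"
    using ext[of Top] sp by auto
  have eqA: "measure \<mu> C = measure \<nu> C" if "C \<in> range A" for C
    using that eq by (auto simp only: A_def)
  have sub: "range A \<subseteq> sets \<mu>"
    unfolding \<mu>'(2) using A by (rule image_subsetI)
  have "measure \<mu> B = measure \<nu> B" if "B \<in> sigma_sets (space S) (range A)" for B
    using \<mu>'(1) \<nu>'(1) trans[OF \<mu>'(2) \<nu>'(2)[symmetric]] sub stable top eqA that[folded sp]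
    by (rule measure_eq_on_sigma_sets)
  then have "measure \<mu> Q = measure \<nu> Q"
  proof (rule measure_eq_on_saturated_set[OF S A Q(1) \<mu>' \<nu>'])
    fix x y assume x: "x \<in> space S" and y: "y \<in> Q" and xy: "\<And>n. x \<in> A n \<longleftrightarrow> y \<in> A n"
    have "y \<in> space S" using y Q(1) sets.sets_into_space by blast
    moreover have "state_sat S P \<phi> y \<longleftrightarrow> state_sat S P \<phi> x" for \<phi>
      using xy[of "to_nat \<phi>"] x \<open>y \<in> space S\<close> by (simp add: A_def)
    ultimately have "(y, x) \<in> R" using R x by blast
    then show "x \<in> Q" using Q(2) y by (auto simp: rel_closed_def)
  qed
  then show "emeasure \<mu> Q = emeasure \<nu> Q"
    using \<mu>'(1) \<nu>'(1) by (simp add: finite_measure.emeasure_eq_measure)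
qed

lemma finitaryE:
  assumes "finitary S P" and "s \<in> space S"
  obtains J where "finite J" and "\<forall>K\<in>J. finite K \<and> K \<subseteq> space (subprob_algebra S)"
    and "P s = (\<Union>K\<in>J. up_set S K)"
proof -
  from bspec[OF assms(1)[unfolded finitary_def] assms(2)] obtain n :: nat and \<kappa>
    where \<kappa>: "\<forall>i\<in>{1..n}. finite (\<kappa> i) \<and> \<kappa> i \<subseteq> space (subprob_algebra S)"
      and Ps: "P s = (\<Union>i\<in>{1..n}. up_set S (\<kappa> i))"
    by (elim exE conjE)
  show thesis
  proof (rule that)
    show "\<forall>K\<in>\<kappa> ` {1..n}. finite K \<and> K \<subseteq> space (subprob_algebra S)"
      using \<kappa> by fast
    show "P s = (\<Union>K\<in>\<kappa> ` {1..n}. up_set S K)"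
      unfolding Ps by (simp only: image_image)
  qed simp
qed

theorem theorem4p22:
  fixes S :: "'a measure" and P :: "'a \<Rightarrow> 'a measure set set" and s t :: 'a
  assumes "standard_borel S"
    and "stochastic_effectivity S P"
    and "finitary S P"
    and "s \<in> space S" and "t \<in> space S"
    and "\<forall>\<phi>. state_sat S P \<phi> s \<longleftrightarrow> state_sat S P \<phi> t"
  shows "\<exists>R. state_bisimulation S P R \<and> (s, t) \<in> R"
proof -
  define R where "R = {(x, y). x \<in> space S \<and> y \<in> space S \<and>
    (\<forall>\<phi>. state_sat S P \<phi> x \<longleftrightarrow> state_sat S P \<phi> y)}"
  let ?ext = "\<lambda>\<phi>. {s \<in> space S. state_sat S P \<phi> s}"
  have P: "t_measurable S P" using assms(2) by (simp add: stochastic_effectivity_def)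
  have step: "\<exists>B\<in>P y. \<forall>\<nu>\<in>B. \<exists>\<mu>\<in>A. lift_rel S R \<mu> \<nu>" if xy: "(x, y) \<in> R" and A: "A \<in> P x" for x y A
  proof -
    have x: "x \<in> space S" and y: "y \<in> space S"
      and sat: "\<forall>\<phi>. state_sat S P \<phi> x \<longleftrightarrow> state_sat S P \<phi> y"
      using xy by (auto simp: R_def)
    obtain I where I: "finite I" "\<forall>K\<in>I. finite K \<and> K \<subseteq> space (subprob_algebra S)"
      "P x = (\<Union>K\<in>I. up_set S K)" by (rule finitaryE[OF assms(3) x])
    obtain J where J: "finite J" "\<forall>K\<in>J. finite K \<and> K \<subseteq> space (subprob_algebra S)"
      "P y = (\<Union>K\<in>J. up_set S K)" by (rule finitaryE[OF assms(3) y])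
    obtain K where "K \<in> I" and KA: "K \<subseteq> A" using A I(3) by (auto simp: up_set_def)
    then have K: "finite K" "K \<subseteq> space (subprob_algebra S)" using I(2) by auto
    define agree where "agree \<mu> \<nu> \<longleftrightarrow> (\<forall>\<phi>. measure \<mu> (?ext \<phi>) = measure \<nu> (?ext \<phi>))" for \<mu> \<nu>
    define B where "B = {\<nu> \<in> space (subprob_algebra S). \<exists>\<mu>\<in>K. agree \<mu> \<nu>}"
    \<comment> \<open>\<open>K\<close> is finite, there are countably many formulas, and each
      evaluation is measurable.\<close>
    have "B \<in> sets (subprob_algebra S)"
      unfolding B_def agree_def
    proof (intro sets.sets_Collect_finite_Ex[OF _ K(1)] sets.sets_Collect_countable_All)
      fix \<mu> \<phi>
      have "(\<lambda>\<nu>. measure \<nu> (?ext \<phi>)) \<in> borel_measurable (subprob_algebra S)"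
        by (rule measurable_measure_subprob_algebra[OF sets_state_sat[OF P]])
      then show "{\<nu> \<in> space (subprob_algebra S). measure \<mu> (?ext \<phi>) = measure \<nu> (?ext \<phi>)}
          \<in> sets (subprob_algebra S)" by simp
    qed
    have "\<exists>L\<in>J. L \<subseteq> B"
    proof (rule ccontr)
      assume "\<not> (\<exists>L\<in>J. L \<subseteq> B)"
      then have "\<forall>L\<in>J. \<exists>\<nu>\<in>L. \<nu> \<notin> B" by blast
      then obtain \<nu> where \<nu>: "\<And>L. L \<in> J \<Longrightarrow> \<nu> L \<in> L" "\<And>L. L \<in> J \<Longrightarrow> \<nu> L \<notin> B" by metis
      have "\<exists>\<psi>. measure_sat S P \<psi> \<mu> \<and> \<not> measure_sat S P \<psi> (\<nu> L)" if \<mu>: "\<mu> \<in> K" and L: "L \<in> J" for \<mu> L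
      proof -
        have \<nu>L: "\<nu> L \<in> space (subprob_algebra S)"
          using bspec[OF J(2) L] \<nu>(1)[OF L] by auto
        then obtain \<phi> where \<phi>: "measure \<mu> (?ext \<phi>) \<noteq> measure (\<nu> L) (?ext \<phi>)"
          using \<nu>(2)[OF L] \<mu> by (auto simp: B_def agree_def)
        show ?thesis
          by (rule separating_measure_formula[OF subsetD[OF K(2) \<mu>] \<nu>L \<phi>])
      qed
      then obtain f where f: "\<And>\<mu> L. \<mu> \<in> K \<Longrightarrow> L \<in> J \<Longrightarrow>
          measure_sat S P (f \<mu> L) \<mu> \<and> \<not> measure_sat S P (f \<mu> L) (\<nu> L)" by metis
      \<comment> \<open>For \<mu> in \<open>K\<close> the conjunction \<open>g \<mu>\<close> holds
        at \<mu> and fails at every \<open>\<nu> L\<close>. The disjunction \<psi> below therefore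
        holds on all of \<open>K\<close> and at no \<open>\<nu> L\<close>.\<close>
      have "\<forall>\<mu>. \<exists>\<psi>. \<forall>\<rho>. measure_sat S P \<psi> \<rho> \<longleftrightarrow> (\<forall>L\<in>J. measure_sat S P (f \<mu> L) \<rho>)"
        by (intro allI ex_finite_MConj[OF J(1)])
      then obtain g where g: "\<forall>\<mu> \<rho>. measure_sat S P (g \<mu>) \<rho> \<longleftrightarrow> (\<forall>L\<in>J. measure_sat S P (f \<mu> L) \<rho>)"
        unfolding choice_iff by (rule exE)
      obtain \<psi> where \<psi>: "\<And>\<rho>. measure_sat S P \<psi> \<rho> \<longleftrightarrow> (\<exists>\<mu>\<in>K. measure_sat S P (g \<mu>) \<rho>)"
        using ex_finite_MDisj[OF K(1), of S P g] by blast
      let ?D = "{\<rho> \<in> space (subprob_algebra S). measure_sat S P \<psi> \<rho>}"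
      have "\<mu> \<in> ?D" if "\<mu> \<in> K" for \<mu>
        using subsetD[OF K(2) that] f[OF that] that by (auto simp: \<psi> g)
      then have "K \<subseteq> ?D" by (rule subsetI)
      then have "state_sat S P (Diamond \<psi>) x"
        using sets_measure_sat[OF P] \<open>K \<in> I\<close> unfolding state_sat.simps I(3) up_set_def by blast
      \<comment> \<open>Equivalence of \<open>x\<close> and \<open>y\<close> is applied to this
        single formula: some generator \<open>L\<close> of \<open>P y\<close> must satisfy \<psi>
        throughout, including at its own witness \<open>\<nu> L\<close>.\<close>
      then have "state_sat S P (Diamond \<psi>) y" by (rule sat[rule_format, THEN iffD1])
      then obtain L where L: "L \<in> J" "L \<subseteq> ?D" unfolding state_sat.simps J(3) up_set_def by blast
      then have "measure_sat S P \<psi> (\<nu> L)" using \<nu>(1) by blast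
      then obtain \<mu> where "\<mu> \<in> K" "measure_sat S P (f \<mu> L) (\<nu> L)"
        using L(1) by (auto simp: \<psi> g)
      then show False using f L(1) by blast
    qed
    then obtain L where "L \<in> J" "L \<subseteq> B" by (rule bexE)
    with \<open>B \<in> sets (subprob_algebra S)\<close> have "B \<in> P y"
      unfolding J(3) up_set_def by blast
    moreover have "\<exists>\<mu>\<in>A. lift_rel S R \<mu> \<nu>" if \<nu>: "\<nu> \<in> B" for \<nu>
    proof -
      obtain \<mu> where \<mu>: "\<mu> \<in> K" "agree \<mu> \<nu>" using \<nu> by (auto simp: B_def)
      have "lift_rel S R \<mu> \<nu>"
        by (rule lift_rel_if_formulas_agree[OF assms(1) P])
          (use \<mu> K(2) \<nu> in \<open>auto simp: B_def agree_def R_def\<close>)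
      then show ?thesis using \<mu>(1) KA by blast
    qed
    ultimately show ?thesis by blast
  qed
  have "state_bisimulation S P R"
    unfolding state_bisimulation_def
  proof (intro conjI)
    show "R \<subseteq> space S \<times> space S" "sym R" by (auto simp: R_def sym_def)
    show "\<forall>(s, t)\<in>R. \<forall>A\<in>P s. \<exists>B\<in>P t. \<forall>\<nu>\<in>B. \<exists>\<mu>\<in>A. lift_rel S R \<mu> \<nu>"
      by clarify (rule step)
  qed
  moreover have "(s, t) \<in> R" using assms(4-6) by (simp add: R_def)
  ultimately show ?thesis by blast
qed

end
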